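(* Let $a(z)=\sum_{i\in\mathbb Z}a_iz^i$ be such that $a(z),a'(z)\in\mathcal W$, let $E\in\mathcal F$, and let $A=T(a)+E$. Define $$D_i=A^i-T(a^i)\quad (i\ge 0),\qquad F_k=\sum_{i=0}^k\frac1{i!}D_i,\qquad F=\lim_{k\to\infty}F_k,$$ $$\gamma_i=(i-1)\|a\|_{\mathcal W}^{i-2}\|a'\|_{\mathcal W}^2+\|a\|_{\mathcal W}^{i-1}\|E\|_{\mathcal F}\quad (i\ge 1).$$ Then for every $i\ge 0$ $$\|D_i\|_{\mathcal F}\le\sum_{j=0}^{i-1}\left(\|a\|_{\mathcal W}+\|E\|_{\mathcal F}\right)^j\gamma_{i-j},$$ and $$\|F\|_{\mathcal F}\le\left(\tfrac12\|a'\|_{\mathcal W}^2+\|E\|_{\mathcal F}\right)\exp\left(\|a\|_{\mathcal W}+\|E\|_{\mathcal F}\right).$$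
   Context: $\mathbb Z^+$ is the set of positive integers. $\mathcal W$ is the Wiener algebra of complex Laurent series $a(z)=\sum_{i\in\mathbb Z}a_iz^i$ on the unit circle $|z|=1$ with $\|a\|_{\mathcal W}=\sum_{i\in\mathbb Z}|a_i|<\infty$; it is a Banach algebra, so $a^i\in\mathcal W$ and $\exp(a)=\sum_{i\ge0}\frac1{i!}a^i\in\mathcal W$. The derivative is $a'(z)=\sum_{i\in\mathbb Z}ia_iz^{i-1}$, so $\|a'\|_{\mathcal W}=\sum_{i\in\mathbb Z}|ia_i|$. For $a\in\mathcal W$, $T(a)=(t_{i,j})_{i,j\in\mathbb Z^+}$ is the semi-infinite Toeplitz matrix with $t_{i,j}=a_{j-i}$. For a semi-infinite complex matrix $S=(s_{i,j})_{i,j\in\mathbb Z^+}$, $\|S\|_{\mathcal F}=\sum_{i,j\in\mathbb Z^+}|s_{i,j}|$, and $\mathcal F$ is the set of semi-infinite matrices $S$ with $\|S\|_{\mathcal F}<\infty$. Semi-infinite matrices are regarded as linear operators on $\ell^p=\ell^p(\mathbb Z^+)$, $1\le p\le\infty$; $A^0$ is the identity. Since $T(a)$ and $E$ are bounded on $\ell^p$, $\exp(A)=\sum_{i\ge0}\frac1{i!}A^i$ is well defined there. The limit defining $F$ is taken in the $\ell^p$ operator norm; it exists and equals $F=\exp(A)-T(\exp(a))$. Conventions: an empty sum is $0$; $0^0=1$; a product with a zero integer coefficient (such as $(i-1)\|a\|_{\mathcal W}^{i-2}$ for $i=1$) is $0$, even when $\|a\|_{\mathcal W}=0$. *)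

theory Defs
  imports "HOL-Analysis.Analysis"
begin

text \<open>
  A Laurent series \<open>a(z) = \<Sum>\<^sub>i a\<^sub>i z\<^sup>i\<close> on the unit circle is represented by its
  two-sided coefficient sequence \<open>i \<mapsto> a\<^sub>i\<close>.
\<close>

definition wiener :: "(int \<Rightarrow> complex) set" where
  "wiener = {a. (\<lambda>i. cmod (a i)) summable_on UNIV}"

definition wiener_norm :: "(int \<Rightarrow> complex) \<Rightarrow> real" where
  "wiener_norm a = (\<Sum>\<^sub>\<infinity>i. cmod (a i))"

definition laurent_mult :: "(int \<Rightarrow> complex) \<Rightarrow> (int \<Rightarrow> complex) \<Rightarrow> int \<Rightarrow> complex" where
  "laurent_mult a b = (\<lambda>n. \<Sum>\<^sub>\<infinity>k. a k * b (n - k))"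

primrec laurent_power :: "(int \<Rightarrow> complex) \<Rightarrow> nat \<Rightarrow> int \<Rightarrow> complex" where
  "laurent_power a 0 = (\<lambda>n. if n = 0 then 1 else 0)"
| "laurent_power a (Suc m) = laurent_mult a (laurent_power a m)"

text \<open>The coefficient of \<open>z\<^sup>n\<close> in \<open>a'(z) = \<Sum>\<^sub>i i a\<^sub>i z\<^bsup>i-1\<^esup>\<close> is \<open>(n + 1) a\<^bsub>n+1\<^esub>\<close>.\<close>

definition laurent_deriv :: "(int \<Rightarrow> complex) \<Rightarrow> int \<Rightarrow> complex" where
  "laurent_deriv a = (\<lambda>n. of_int (n + 1) * a (n + 1))"

text \<open>
  Semi-infinite matrices and sequences are indexed by \<open>nat\<close>: index \<open>i\<close> here stands for the
  positive integer \<open>i + 1\<close>.  The Toeplitz entries depend only on \<open>j - i\<close>, so they are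
  unaffected by this shift.
\<close>

type_synonym smat = "nat \<Rightarrow> nat \<Rightarrow> complex"

definition toeplitz :: "(int \<Rightarrow> complex) \<Rightarrow> smat" where
  "toeplitz a = (\<lambda>i j. a (int j - int i))"

definition mat_mult :: "smat \<Rightarrow> smat \<Rightarrow> smat" where
  "mat_mult S R = (\<lambda>i j. \<Sum>\<^sub>\<infinity>k. S i k * R k j)"

primrec mat_power :: "smat \<Rightarrow> nat \<Rightarrow> smat" where
  "mat_power S 0 = (\<lambda>i j. if i = j then 1 else 0)"
| "mat_power S (Suc m) = mat_mult S (mat_power S m)"

definition fmat :: "smat set" where
  "fmat = {S. (\<lambda>(i, j). cmod (S i j)) summable_on UNIV}"

text \<open>Meaningful only on \<open>fmat\<close>: an \<open>infsum\<close> that does not converge is \<open>0\<close>.\<close>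

definition fmat_norm :: "smat \<Rightarrow> real" where
  "fmat_norm S = (\<Sum>\<^sub>\<infinity>(i, j). cmod (S i j))"

definition lp_space :: "ennreal \<Rightarrow> (nat \<Rightarrow> complex) set" where
  "lp_space p =
    (if p = \<infinity> then {x. bounded (range x)}
     else {x. (\<lambda>i. cmod (x i) powr enn2real p) summable_on UNIV})"

definition lp_norm :: "ennreal \<Rightarrow> (nat \<Rightarrow> complex) \<Rightarrow> real" where
  "lp_norm p x =
    (if p = \<infinity> then (SUP i. cmod (x i))
     else (\<Sum>\<^sub>\<infinity>i. cmod (x i) powr enn2real p) powr (1 / enn2real p))"

definition mat_apply :: "smat \<Rightarrow> (nat \<Rightarrow> complex) \<Rightarrow> nat \<Rightarrow> complex" where
  "mat_apply S x = (\<lambda>i. \<Sum>\<^sub>\<infinity>j. S i j * x j)"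

definition lp_bounded_op :: "ennreal \<Rightarrow> smat \<Rightarrow> bool" where
  "lp_bounded_op p S \<longleftrightarrow>
    (\<forall>x\<in>lp_space p. (\<forall>i. (\<lambda>j. S i j * x j) summable_on UNIV) \<and> mat_apply S x \<in> lp_space p) \<and>
    (\<exists>C. \<forall>x\<in>lp_space p. lp_norm p (mat_apply S x) \<le> C * lp_norm p x)"

definition lp_opnorm :: "ennreal \<Rightarrow> smat \<Rightarrow> real" where
  "lp_opnorm p S = (SUP x \<in> {x \<in> lp_space p. lp_norm p x \<le> 1}. lp_norm p (mat_apply S x))"

definition lp_op_tendsto :: "ennreal \<Rightarrow> (nat \<Rightarrow> smat) \<Rightarrow> smat \<Rightarrow> bool" where
  "lp_op_tendsto p M S \<longleftrightarrow>
    (\<forall>k. lp_bounded_op p (M k)) \<and> lp_bounded_op p S \<and>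
    (\<lambda>k. lp_opnorm p (\<lambda>i j. M k i j - S i j)) \<longlonglongrightarrow> 0"

definition lp_op_lim :: "ennreal \<Rightarrow> (nat \<Rightarrow> smat) \<Rightarrow> smat" where
  "lp_op_lim p M = (THE S. lp_op_tendsto p M S)"

end

theory Submission
  imports Defs
begin

text \<open>
  Write \<open>b = a\<^sup>n\<close>. Then \<open>D\<^sub>n\<^sub>+\<^sub>1 = A D\<^sub>n + E T(b) + (T(a) T(b) - T(ab))\<close>, and the last summand is minus a
  product of two Hankel matrices, of \<open>\<F>\<close>-norm at most \<open>\<parallel>a'\<parallel> \<parallel>b'\<parallel> \<le> n \<parallel>a\<parallel>\<^sup>n\<^sup>-\<^sup>1 \<parallel>a'\<parallel>\<^sup>2\<close>; hence
  \<open>\<parallel>D\<^sub>n\<^sub>+\<^sub>1\<parallel> \<le> (\<parallel>a\<parallel> + \<parallel>E\<parallel>) \<parallel>D\<^sub>n\<parallel> + \<gamma>\<^sub>n\<^sub>+\<^sub>1\<close>. Unfolding this recursion gives the first bound. With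
  \<open>c = \<parallel>a\<parallel> + \<parallel>E\<parallel>\<close> it also gives
  \<open>\<parallel>D\<^sub>n\<parallel> \<le> \<onehalf> n (n - 1) c\<^sup>n\<^sup>-\<^sup>2 \<parallel>a'\<parallel>\<^sup>2 + n c\<^sup>n\<^sup>-\<^sup>1 \<parallel>E\<parallel>\<close>, and dividing by \<open>n!\<close> and summing gives the
  second. Convergence takes place in \<open>\<F>\<close>, whose norm dominates every \<open>\<ell>\<^sup>p\<close> operator norm. Sums of
  absolute values are handled as \<open>ennreal\<close>-valued integrals over counting measure, so that they can
  be interchanged without summability conditions.
\<close>

section \<open>Norm estimates for Laurent series and semi-infinite matrices\<close>

abbreviation esum :: "('a \<Rightarrow> ennreal) \<Rightarrow> ennreal" where
  "esum f \<equiv> \<integral>\<^sup>+x. f x \<partial>count_space UNIV"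

lemma esum_swap: "esum (\<lambda>x. esum (\<lambda>y. f x y)) = esum (\<lambda>y. esum (\<lambda>x. f x y))"
  using nn_integral_fst_count_space[of "case_prod f"] nn_integral_snd_count_space[of "case_prod f"]
  by simp

lemma esum_add: "esum (\<lambda>x. f x + g x) = esum f + esum g"
  by (rule nn_integral_add) auto

lemma esum_mono: "(\<And>x. f x \<le> g x) \<Longrightarrow> esum f \<le> esum g"
  by (rule nn_integral_mono) auto

text \<open>Reindexing along an injection samples only part of the terms. Rows and columns of a
  Toeplitz matrix sample its coefficients in this way.\<close>

lemma esum_inj_le:
  assumes "inj g"
  shows "esum (\<lambda>x. f (g x)) \<le> esum f"
proof -
  have "esum (\<lambda>x. f (g x)) = (\<integral>\<^sup>+x. f x \<partial>count_space (range g))"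
    using assms by (intro nn_integral_bij_count_space) (simp add: bij_betw_def)
  also have "\<dots> \<le> esum f"
    by (subst nn_integral_count_space_indicator) (auto intro!: nn_integral_mono simp: indicator_def)
  finally show ?thesis .
qed

lemma esum_upper: "f x \<le> esum f"
  \<comment> \<open>A single term is the sum along an injection from the one-point type.\<close>
  using esum_inj_le[of "\<lambda>_::unit. x" f] by (simp add: nn_integral_count_space_finite inj_def)

lemma infsum_conv_nn_integral:
  fixes f :: "'a \<Rightarrow> real"
  assumes "f summable_on A" "\<And>x. x \<in> A \<Longrightarrow> 0 \<le> f x"
  shows "(\<integral>\<^sup>+x. ennreal (f x) \<partial>count_space A) = ennreal (infsum f A)"
proof -
  have s: "Infinite_Set_Sum.abs_summable_on f A"
    using assms(1) by (metis summable_on_iff_abs_summable_on_real abs_summable_equivalent)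
  show ?thesis
    using nn_integral_conv_infsetsum[OF s assms(2)] unfolding infsetsum_infsum[OF s] .
qed

lemma norm_summable_iff_nn_integral:
  fixes f :: "'a \<Rightarrow> 'b::{banach,second_countable_topology}"
  shows "(\<lambda>x. norm (f x)) summable_on A \<longleftrightarrow> (\<integral>\<^sup>+x. ennreal (norm (f x)) \<partial>count_space A) < top"
  unfolding abs_summable_equivalent abs_summable_on_def by (simp add: integrable_iff_bounded)

text \<open>This is the triangle inequality if the norms are summable; otherwise the right-hand side
  is \<open>top\<close>. Entries of products can thus be estimated before any convergence is
  known.\<close>

lemma norm_infsum_le_nn_integral:
  fixes f :: "'a \<Rightarrow> 'b::{banach,second_countable_topology}"
  shows "ennreal (norm (infsum f A)) \<le> (\<integral>\<^sup>+x. ennreal (norm (f x)) \<partial>count_space A)"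
proof (cases "(\<lambda>x. norm (f x)) summable_on A")
  case True
  show ?thesis
    by (subst infsum_conv_nn_integral[OF True]) (simp_all only: norm_ge_zero ennreal_leI norm_infsum_bound[OF True])
next
  case False
  then have "(\<integral>\<^sup>+x. ennreal (norm (f x)) \<partial>count_space A) = top"
    unfolding norm_summable_iff_nn_integral by (metis less_top)
  then show ?thesis
    by (simp only: top_greatest)
qed

section \<open>Norms with values in the extended nonnegative reals\<close>

definition enorm_wiener :: "(int \<Rightarrow> complex) \<Rightarrow> ennreal" where
  "enorm_wiener a = esum (\<lambda>n. ennreal (cmod (a n)))"

text \<open>The weight sits at the coefficient's own index, which suits convolutions;
  \<open>enorm_deriv_eq\<close> undoes the shift by one in \<open>laurent_deriv\<close>.\<close>

definition enorm_deriv :: "(int \<Rightarrow> complex) \<Rightarrow> ennreal" where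
  "enorm_deriv a = esum (\<lambda>n. ennreal (\<bar>of_int n\<bar> * cmod (a n)))"

text \<open>The iterated form lets \<open>esum_swap\<close> separate row sums from column
  sums.\<close>

definition enorm_fmat :: "smat \<Rightarrow> ennreal" where
  "enorm_fmat S = esum (\<lambda>i. esum (\<lambda>j. ennreal (cmod (S i j))))"

lemma wiener_iff: "a \<in> wiener \<longleftrightarrow> enorm_wiener a < top"
  unfolding wiener_def enorm_wiener_def mem_Collect_eq by (rule norm_summable_iff_nn_integral)

lemma enorm_wiener_eq: "a \<in> wiener \<Longrightarrow> enorm_wiener a = ennreal (wiener_norm a)"
  by (simp add: wiener_def enorm_wiener_def wiener_norm_def infsum_conv_nn_integral)

lemma wiener_norm_nonneg: "0 \<le> wiener_norm a"
  by (simp add: wiener_norm_def infsum_nonneg)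

lemma enorm_fmat_pairs: "enorm_fmat S = esum (\<lambda>x. ennreal (norm (case_prod S x)))"
  using nn_integral_fst_count_space[of "\<lambda>x. ennreal (norm (case_prod S x))"]
  by (simp add: enorm_fmat_def)

lemma fmat_alt: "S \<in> fmat \<longleftrightarrow> (\<lambda>x. norm (case_prod S x)) summable_on UNIV"
  by (simp add: fmat_def case_prod_beta')

lemma fmat_iff: "S \<in> fmat \<longleftrightarrow> enorm_fmat S < top"
  by (simp only: fmat_alt enorm_fmat_pairs norm_summable_iff_nn_integral)

lemma enorm_fmat_eq: "S \<in> fmat \<Longrightarrow> enorm_fmat S = ennreal (fmat_norm S)"
  unfolding fmat_alt enorm_fmat_pairs fmat_norm_def
  by (subst infsum_conv_nn_integral) (simp_all add: case_prod_beta')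

lemma fmat_norm_nonneg: "0 \<le> fmat_norm S"
  by (auto simp: fmat_norm_def intro!: infsum_nonneg)

lemma enorm_deriv_eq: "enorm_wiener (laurent_deriv a) = enorm_deriv a"
proof -
  have "bij (\<lambda>n::int. n + 1)"
    by (rule bij_betwI[of _ _ _ "\<lambda>n. n - 1"]) auto
  from nn_integral_bij_count_space[OF this, of "\<lambda>n. ennreal (\<bar>of_int n\<bar> * cmod (a n))"]
  show ?thesis
    by (simp add: enorm_wiener_def laurent_deriv_def enorm_deriv_def norm_mult flip: of_int_add)
qed

lemma enorm_wiener_upper: "ennreal (cmod (a n)) \<le> enorm_wiener a"
  unfolding enorm_wiener_def by (rule esum_upper)

lemma cmod_le_wiener_norm: "a \<in> wiener \<Longrightarrow> cmod (a n) \<le> wiener_norm a"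
  using enorm_wiener_upper[of a n] by (simp add: enorm_wiener_eq wiener_norm_nonneg)

lemma enorm_fmat_upper: "ennreal (cmod (S i j)) \<le> enorm_fmat S"
proof -
  have "ennreal (cmod (S i j)) \<le> esum (\<lambda>j. ennreal (cmod (S i j)))"
    by (rule esum_upper)
  also have "\<dots> \<le> enorm_fmat S"
    unfolding enorm_fmat_def by (rule esum_upper)
  finally show ?thesis .
qed

lemma cmod_le_fmat_norm: "S \<in> fmat \<Longrightarrow> cmod (S i j) \<le> fmat_norm S"
  using enorm_fmat_upper[of S i j] by (simp add: enorm_fmat_eq fmat_norm_nonneg)

section \<open>Products and powers of Laurent series\<close>

lemma laurent_mult_le:
  "ennreal (cmod (laurent_mult a b n)) \<le> esum (\<lambda>k. ennreal (cmod (a k)) * ennreal (cmod (b (n - k))))"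
  using norm_infsum_le_nn_integral[of "\<lambda>k. a k * b (n - k)" UNIV]
  by (simp add: laurent_mult_def norm_mult ennreal_mult)

text \<open>Interchange the sums, then use translation invariance over the integers. General
  \<open>f\<close> and \<open>g\<close> allow weighted coefficients as well.\<close>

lemma esum_convolution:
  fixes f g :: "int \<Rightarrow> ennreal"
  shows "esum (\<lambda>n. esum (\<lambda>k. f k * g (n - k))) = esum f * esum g"
proof -
  have shift: "esum (\<lambda>n. g (n - k)) = esum g" for k
    by (rule nn_integral_bij_count_space, rule bij_betwI[of _ _ _ "\<lambda>n. n + k"]) auto
  show ?thesis
    by (subst esum_swap) (simp add: nn_integral_cmult nn_integral_multc shift)
qed

lemma enorm_wiener_mult: "enorm_wiener (laurent_mult a b) \<le> enorm_wiener a * enorm_wiener b"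
proof -
  have "enorm_wiener (laurent_mult a b)
      \<le> esum (\<lambda>n. esum (\<lambda>k. ennreal (cmod (a k)) * ennreal (cmod (b (n - k)))))"
    unfolding enorm_wiener_def by (intro esum_mono laurent_mult_le)
  then show ?thesis
    using esum_convolution[of "\<lambda>n. ennreal (cmod (a n))" "\<lambda>n. ennreal (cmod (b n))"]
    by (simp add: enorm_wiener_def)
qed

text \<open>The Leibniz rule at the level of norms: split the weight by
  \<open>\<bar>n\<bar> \<le> \<bar>k\<bar> + \<bar>n - k\<bar>\<close> and treat the two halves as
  convolutions.\<close>

lemma enorm_deriv_mult:
  "enorm_deriv (laurent_mult a b) \<le> enorm_deriv a * enorm_wiener b + enorm_wiener a * enorm_deriv b"
proof -
  let ?d = "\<lambda>(a::int \<Rightarrow> complex) n. ennreal (\<bar>of_int n\<bar> * cmod (a n))"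
  let ?w = "\<lambda>(a::int \<Rightarrow> complex) n. ennreal (cmod (a n))"
  have "?d (laurent_mult a b) n
      \<le> esum (\<lambda>k. ?d a k * ?w b (n - k)) + esum (\<lambda>k. ?w a k * ?d b (n - k))" for n
  proof -
    have "?d (laurent_mult a b) n \<le> ennreal \<bar>of_int n\<bar> * esum (\<lambda>k. ?w a k * ?w b (n - k))"
      by (simp add: ennreal_mult mult_left_mono laurent_mult_le)
    also have "\<dots> = esum (\<lambda>k. ennreal \<bar>of_int n\<bar> * (?w a k * ?w b (n - k)))"
      by (simp add: nn_integral_cmult)
    also have "\<dots> \<le> esum (\<lambda>k. ?d a k * ?w b (n - k) + ?w a k * ?d b (n - k))"
    proof (rule esum_mono)
      fix k
      have "\<bar>real_of_int n\<bar> * (cmod (a k) * cmod (b (n - k)))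
          \<le> (\<bar>of_int k\<bar> + \<bar>of_int (n - k)\<bar>) * (cmod (a k) * cmod (b (n - k)))"
        by (intro mult_right_mono) auto
      then show "ennreal \<bar>of_int n\<bar> * (?w a k * ?w b (n - k)) \<le> ?d a k * ?w b (n - k) + ?w a k * ?d b (n - k)"
        by (simp add: algebra_simps ennreal_leI flip: ennreal_mult ennreal_plus)
    qed
    finally show ?thesis
      by (simp add: esum_add)
  qed
  then have "enorm_deriv (laurent_mult a b)
      \<le> esum (\<lambda>n. esum (\<lambda>k. ?d a k * ?w b (n - k)) + esum (\<lambda>k. ?w a k * ?d b (n - k)))"
    unfolding enorm_deriv_def by (rule esum_mono)
  then show ?thesis
    using esum_convolution[of "?d a" "?w b"] esum_convolution[of "?w a" "?d b"]
    by (simp add: esum_add enorm_deriv_def enorm_wiener_def)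
qed

lemma enorm_wiener_power: "enorm_wiener (laurent_power a n) \<le> enorm_wiener a ^ n"
proof (induction n)
  case 0
  have "enorm_wiener (laurent_power a 0) = esum (indicator {0 :: int})"
    unfolding enorm_wiener_def by (rule nn_integral_cong) (simp add: indicator_def)
  then show ?case
    by simp
next
  case (Suc n)
  then show ?case
    using order.trans[OF enorm_wiener_mult mult_left_mono[OF Suc]] by simp
qed

lemma enorm_deriv_power:
  "enorm_deriv (laurent_power a n) \<le> of_nat n * enorm_wiener a ^ (n - 1) * enorm_deriv a"
proof (induction n)
  case 0
  have "enorm_deriv (laurent_power a 0) = esum (\<lambda>_::int. 0)"
    unfolding enorm_deriv_def by (rule nn_integral_cong) simp
  then show ?case
    by simp
next
  case (Suc n)
  have "enorm_deriv (laurent_power a (Suc n))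
      \<le> enorm_deriv a * enorm_wiener a ^ n
        + enorm_wiener a * (of_nat n * enorm_wiener a ^ (n - 1) * enorm_deriv a)"
    using order.trans[OF enorm_deriv_mult add_mono[OF mult_left_mono[OF enorm_wiener_power] mult_left_mono[OF Suc]]]
    by simp
  also have "\<dots> = of_nat (Suc n) * enorm_wiener a ^ (Suc n - 1) * enorm_deriv a"
    \<comment> \<open>For \<open>n = 0\<close> the exponent \<open>n - 1\<close> truncates to 0, but
      the factor \<open>n\<close> removes that term.\<close>
    by (cases n) (simp_all add: algebra_simps)
  finally show ?case .
qed

lemma wiener_power: "a \<in> wiener \<Longrightarrow> laurent_power a n \<in> wiener"
  using enorm_wiener_power[of a n] unfolding wiener_iff
  by (rule le_less_trans) (simp add: power_less_top_ennreal)

section \<open>Sums and products of semi-infinite matrices\<close>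

lemma enorm_fmat_add: "enorm_fmat (\<lambda>i j. S i j + R i j) \<le> enorm_fmat S + enorm_fmat R"
proof -
  have "enorm_fmat (\<lambda>i j. S i j + R i j)
      \<le> esum (\<lambda>i. esum (\<lambda>j. ennreal (cmod (S i j)) + ennreal (cmod (R i j))))"
    unfolding enorm_fmat_def
    by (intro esum_mono) (simp add: norm_triangle_ineq flip: ennreal_plus)
  then show ?thesis
    by (simp add: esum_add enorm_fmat_def)
qed

lemma enorm_fmat_scale: "enorm_fmat (\<lambda>i j. c * S i j) = ennreal (cmod c) * enorm_fmat S"
  by (simp add: enorm_fmat_def norm_mult ennreal_mult nn_integral_cmult)

lemma mat_mult_le:
  "ennreal (cmod (mat_mult S R i j)) \<le> esum (\<lambda>k. ennreal (cmod (S i k)) * ennreal (cmod (R k j)))"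
  using norm_infsum_le_nn_integral[of "\<lambda>k. S i k * R k j" UNIV]
  by (simp add: mat_mult_def norm_mult ennreal_mult)

text \<open>Summing over the outer indices first leaves a column sum of \<open>S\<close> times a row
  sum of \<open>R\<close>. Each product bound below follows by estimating one of the two uniformly
  in \<open>k\<close>.\<close>

lemma enorm_fmat_mult_le:
  "enorm_fmat (mat_mult S R)
     \<le> esum (\<lambda>k. esum (\<lambda>i. ennreal (cmod (S i k))) * esum (\<lambda>j. ennreal (cmod (R k j))))"
proof -
  let ?s = "\<lambda>i k. ennreal (cmod (S i k))" and ?r = "\<lambda>k j. ennreal (cmod (R k j))"
  have "enorm_fmat (mat_mult S R) \<le> esum (\<lambda>i. esum (\<lambda>j. esum (\<lambda>k. ?s i k * ?r k j)))"
    unfolding enorm_fmat_def by (intro esum_mono mat_mult_le)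
  also have "\<dots> = esum (\<lambda>i. esum (\<lambda>k. ?s i k * esum (\<lambda>j. ?r k j)))"
    by (subst esum_swap) (simp add: nn_integral_cmult)
  also have "\<dots> = esum (\<lambda>k. esum (\<lambda>i. ?s i k) * esum (\<lambda>j. ?r k j))"
    by (subst esum_swap) (simp add: nn_integral_multc)
  finally show ?thesis .
qed

lemma esum_toeplitz_row: "esum (\<lambda>j. ennreal (cmod (toeplitz a i j))) \<le> enorm_wiener a"
  unfolding toeplitz_def enorm_wiener_def
  by (rule esum_inj_le[of "\<lambda>j. int j - int i"]) (auto simp: inj_def)

lemma esum_toeplitz_col: "esum (\<lambda>i. ennreal (cmod (toeplitz a i j))) \<le> enorm_wiener a"
  unfolding toeplitz_def enorm_wiener_def
  by (rule esum_inj_le[of "\<lambda>i. int j - int i"]) (auto simp: inj_def)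

text \<open>A nonzero Toeplitz matrix repeats its entries along diagonals and is not absolutely
  summable, but its column sums are uniformly bounded, which suffices here.\<close>

lemma enorm_toeplitz_mult: "enorm_fmat (mat_mult (toeplitz a) S) \<le> enorm_wiener a * enorm_fmat S"
proof -
  have "enorm_fmat (mat_mult (toeplitz a) S)
      \<le> esum (\<lambda>k. enorm_wiener a * esum (\<lambda>j. ennreal (cmod (S k j))))"
    by (rule order.trans[OF enorm_fmat_mult_le]) (intro esum_mono mult_right_mono esum_toeplitz_col zero_le)
  then show ?thesis
    by (simp add: nn_integral_cmult enorm_fmat_def)
qed

lemma enorm_mult_toeplitz: "enorm_fmat (mat_mult S (toeplitz a)) \<le> enorm_fmat S * enorm_wiener a"
proof -
  have "enorm_fmat (mat_mult S (toeplitz a))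
      \<le> esum (\<lambda>k. esum (\<lambda>i. ennreal (cmod (S i k))) * enorm_wiener a)"
    by (rule order.trans[OF enorm_fmat_mult_le]) (intro esum_mono mult_left_mono esum_toeplitz_row zero_le)
  also have "\<dots> = enorm_fmat S * enorm_wiener a"
    using esum_swap[of "\<lambda>i j. ennreal (cmod (S i j))"] by (simp add: nn_integral_multc enorm_fmat_def)
  finally show ?thesis .
qed

lemma enorm_fmat_mult: "enorm_fmat (mat_mult S R) \<le> enorm_fmat S * enorm_fmat R"
proof -
  have "enorm_fmat (mat_mult S R)
      \<le> esum (\<lambda>k. esum (\<lambda>i. ennreal (cmod (S i k))) * enorm_fmat R)"
    unfolding enorm_fmat_def[of R]
    by (rule order.trans[OF enorm_fmat_mult_le]) (intro esum_mono mult_left_mono esum_upper zero_le)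
  also have "\<dots> = enorm_fmat S * enorm_fmat R"
    using esum_swap[of "\<lambda>i j. ennreal (cmod (S i j))"]
    by (simp add: nn_integral_multc enorm_fmat_def[of S])
  finally show ?thesis .
qed

lemma summable_bounded_mult:
  fixes f g :: "'a \<Rightarrow> complex"
  assumes "(\<lambda>k. cmod (f k)) summable_on A" "\<And>k. k \<in> A \<Longrightarrow> cmod (g k) \<le> B"
  shows "(\<lambda>k. f k * g k) summable_on A"
proof -
  have "(\<lambda>k. cmod (f k) * B) summable_on A"
    using assms(1) by (rule summable_on_cmult_left)
  then have "(\<lambda>k. cmod (f k * g k)) summable_on A"
    by (rule summable_on_comparison_test) (auto simp: norm_mult assms mult_left_mono)
  then show ?thesis
    by (simp add: summable_on_iff_abs_summable_on_complex)
qed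

lemma toeplitz_row_summable: "a \<in> wiener \<Longrightarrow> (\<lambda>j. cmod (toeplitz a i j)) summable_on UNIV"
  using esum_toeplitz_row[of a i] by (simp add: norm_summable_iff_nn_integral wiener_iff le_less_trans)

lemma fmat_row_summable: "S \<in> fmat \<Longrightarrow> (\<lambda>j. cmod (S i j)) summable_on UNIV"
  using esum_upper[of "\<lambda>i. esum (\<lambda>j. ennreal (cmod (S i j)))" i]
  unfolding norm_summable_iff_nn_integral fmat_iff enorm_fmat_def by (rule le_less_trans)

lemma mat_mult_add_left:
  assumes "\<And>i j. (\<lambda>k. S i k * R k j) summable_on UNIV" "\<And>i j. (\<lambda>k. S' i k * R k j) summable_on UNIV"
  shows "mat_mult (\<lambda>i j. S i j + S' i j) R = (\<lambda>i j. mat_mult S R i j + mat_mult S' R i j)"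
  using assms by (simp add: mat_mult_def distrib_right infsum_add)

lemma mat_mult_add_right:
  assumes "\<And>i j. (\<lambda>k. S i k * R k j) summable_on UNIV" "\<And>i j. (\<lambda>k. S i k * R' k j) summable_on UNIV"
  shows "mat_mult S (\<lambda>i j. R i j + R' i j) = (\<lambda>i j. mat_mult S R i j + mat_mult S R' i j)"
  using assms by (simp add: mat_mult_def distrib_left infsum_add)

text \<open>The difference is a product of two Hankel matrices; its inner index \<open>k\<close> runs over the
  negative integers that the semi-infinite product leaves out.\<close>

lemma toeplitz_mult_diff:
  assumes "a \<in> wiener" "b \<in> wiener"
  shows "mat_mult (toeplitz a) (toeplitz b) i j - toeplitz (laurent_mult a b) i j
       = - (\<Sum>\<^sub>\<infinity>k\<in>{..<0}. a (k - int i) * b (int j - k))"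
proof -
  let ?g = "\<lambda>k. a (k - int i) * b (int j - k)"
  have bij: "bij (\<lambda>k. k - int i)"
    by (rule bij_betwI[of _ _ _ "\<lambda>k. k + int i"]) auto
  have "(\<lambda>k. cmod (a (k - int i))) summable_on UNIV"
    using assms(1) summable_on_reindex_bij_betw[OF bij, of "\<lambda>k. cmod (a k)"] by (simp add: wiener_def)
  then have summ: "?g summable_on A" for A
    by (rule summable_on_subset[OF summable_bounded_mult[where B = "wiener_norm b"]])
       (auto intro: cmod_le_wiener_norm assms)
  have "toeplitz (laurent_mult a b) i j = (\<Sum>\<^sub>\<infinity>k. ?g k)"
    using infsum_reindex_bij_betw[OF bij, of "\<lambda>k. a k * b (int j - int i - k)"]
    by (simp add: toeplitz_def laurent_mult_def)
  also have "\<dots> = infsum ?g {0..} + infsum ?g {..<0}"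
  proof -
    have "{0..} \<union> {..<0} = (UNIV :: int set)" "{0..} \<inter> {..<0} = ({} :: int set)"
      by auto
    then show ?thesis
      using infsum_Un_disjoint[OF summ summ, of "{0..}" "{..<0}"] by simp
  qed
  also have "infsum ?g {0..} = mat_mult (toeplitz a) (toeplitz b) i j"
  proof -
    have "bij_betw int UNIV {0..}"
      by (rule bij_betwI[of _ _ _ nat]) auto
    from infsum_reindex_bij_betw[OF this, of ?g] show ?thesis
      by (simp add: mat_mult_def toeplitz_def)
  qed
  finally show ?thesis
    by simp
qed

text \<open>Both derivative norms come from the Hankel structure. On the \<open>b\<close> side all
  indices are positive, so the weight can be inserted as a factor at least 1; on the
  \<open>a\<close> side it counts how often each coefficient occurs.\<close>

lemma enorm_toeplitz_mult_diff:
  assumes "a \<in> wiener" "b \<in> wiener"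
  shows "enorm_fmat (\<lambda>i j. mat_mult (toeplitz a) (toeplitz b) i j - toeplitz (laurent_mult a b) i j)
       \<le> enorm_deriv a * enorm_deriv b"
proof -
  let ?a = "\<lambda>n. ennreal (cmod (a n))" and ?b = "\<lambda>n. ennreal (cmod (b n))"
  let ?I = "\<lambda>k::int. indicator {..<0} k :: ennreal"
  \<comment> \<open>For \<open>k < 0\<close> every index \<open>int j - k\<close> is at least 1. The
    indicator makes the estimate hold for all integers \<open>k\<close>.\<close>
  have tail: "?I k * esum (\<lambda>j. ?b (int j - k)) \<le> ?I k * enorm_deriv b" for k
  proof (cases "k < 0")
    case True
    have "esum (\<lambda>j. ?b (int j - k)) \<le> esum (\<lambda>j. ennreal (\<bar>of_int (int j - k)\<bar> * cmod (b (int j - k))))"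
    proof (intro esum_mono ennreal_leI)
      fix j
      have "1 * cmod (b (int j - k)) \<le> \<bar>of_int (int j - k)\<bar> * cmod (b (int j - k))"
        using True by (intro mult_right_mono) auto
      then show "cmod (b (int j - k)) \<le> \<bar>of_int (int j - k)\<bar> * cmod (b (int j - k))"
        by simp
    qed
    also have "\<dots> \<le> enorm_deriv b"
      unfolding enorm_deriv_def by (rule esum_inj_le[of "\<lambda>j. int j - k"]) (auto simp: inj_def)
    finally show ?thesis
      by (rule mult_left_mono) simp
  qed simp
  have count: "esum (\<lambda>k. ?I k * esum (\<lambda>i. ?a (k - int i))) \<le> enorm_deriv a"
  proof -
    have "esum (\<lambda>k. ?I k * esum (\<lambda>i. ?a (k - int i))) = esum (\<lambda>i. esum (\<lambda>k. ?I k * ?a (k - int i)))"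
      by (subst esum_swap) (simp add: nn_integral_cmult)
    also have "\<dots> = esum (\<lambda>i. esum (\<lambda>s. ?I (s + int i) * ?a s))"
    proof (rule nn_integral_cong)
      fix i
      have "bij (\<lambda>s. s + int i)"
        by (rule bij_betwI[of _ _ _ "\<lambda>k. k - int i"]) auto
      from nn_integral_bij_count_space[OF this, of "\<lambda>k. ?I k * ?a (k - int i)"]
      show "esum (\<lambda>k. ?I k * ?a (k - int i)) = esum (\<lambda>s. ?I (s + int i) * ?a s)"
        by simp
    qed
    also have "\<dots> = esum (\<lambda>s. esum (\<lambda>i. ?I (s + int i)) * ?a s)"
      by (subst esum_swap) (simp add: nn_integral_multc)
    also have "\<dots> \<le> enorm_deriv a"
      unfolding enorm_deriv_def
    proof (rule esum_mono)
      fix s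
      \<comment> \<open>With \<open>s = k - int i\<close>, the condition \<open>k < 0\<close> reads
        \<open>int i < - s\<close>, so \<open>a s\<close> is counted \<open>nat (- s)\<close> times,
        and never for \<open>s \<ge> 0\<close>.\<close>
      have "esum (\<lambda>i. ?I (s + int i)) = esum (indicator {..<nat (- s)})"
        by (rule nn_integral_cong) (auto simp: indicator_def)
      also have "\<dots> = of_nat (nat (- s))"
        by simp
      also have "\<dots> \<le> ennreal \<bar>of_int s\<bar>"
        unfolding ennreal_of_nat_eq_real_of_nat by (rule ennreal_leI) simp
      finally show "esum (\<lambda>i. ?I (s + int i)) * ?a s \<le> ennreal (\<bar>of_int s\<bar> * cmod (a s))"
        by (simp add: ennreal_mult mult_right_mono)
    qed
    finally show ?thesis .
  qed
  have "ennreal (cmod (mat_mult (toeplitz a) (toeplitz b) i j - toeplitz (laurent_mult a b) i j))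
      \<le> esum (\<lambda>k. ?I k * (?a (k - int i) * ?b (int j - k)))" for i j
    using norm_infsum_le_nn_integral[of "\<lambda>k. a (k - int i) * b (int j - k)" "{..<0}"]
    unfolding toeplitz_mult_diff[OF assms]
    by (simp add: norm_mult ennreal_mult nn_integral_count_space_indicator mult.commute)
  then have "enorm_fmat (\<lambda>i j. mat_mult (toeplitz a) (toeplitz b) i j - toeplitz (laurent_mult a b) i j)
      \<le> esum (\<lambda>i. esum (\<lambda>j. esum (\<lambda>k. ?I k * (?a (k - int i) * ?b (int j - k)))))"
    unfolding enorm_fmat_def by (intro esum_mono)
  also have "\<dots> = esum (\<lambda>i. esum (\<lambda>k. ?I k * (?a (k - int i) * esum (\<lambda>j. ?b (int j - k)))))"
    by (subst esum_swap) (simp add: nn_integral_cmult)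
  also have "\<dots> = esum (\<lambda>k. (?I k * esum (\<lambda>j. ?b (int j - k))) * esum (\<lambda>i. ?a (k - int i)))"
    by (subst esum_swap) (simp add: nn_integral_cmult nn_integral_multc ac_simps)
  also have "\<dots> \<le> esum (\<lambda>k. (?I k * enorm_deriv b) * esum (\<lambda>i. ?a (k - int i)))"
    by (intro esum_mono mult_right_mono tail zero_le)
  also have "\<dots> = esum (\<lambda>k. ?I k * esum (\<lambda>i. ?a (k - int i))) * enorm_deriv b"
    by (subst nn_integral_multc[symmetric]) (simp_all add: ac_simps)
  also have "\<dots> \<le> enorm_deriv a * enorm_deriv b"
    by (intro mult_right_mono count zero_le)
  finally show ?thesis .
qed

section \<open>Operators on \<open>\<ell>\<^sup>p\<close>\<close>

lemma lp_exponent_cases: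
  fixes p :: ennreal
  assumes "1 \<le> p"
  obtains (inf) "p = \<infinity>" | (fin) "p \<noteq> \<infinity>" "1 \<le> enn2real p"
proof (cases p)
  case (real r)
  then show ?thesis
    using assms fin by (simp flip: ennreal_1)
qed (use inf in simp)

lemma lp_entry_le:
  assumes "1 \<le> p" "x \<in> lp_space p"
  shows "cmod (x i) \<le> lp_norm p x"
  using assms(1)
proof (cases rule: lp_exponent_cases)
  case inf
  then have "bounded (range x)"
    using assms(2) by (simp add: lp_space_def)
  then have "bdd_above (range (\<lambda>i. cmod (x i)))"
    by (simp add: bdd_above_norm[symmetric] image_image)
  then show ?thesis
    using inf by (auto simp: lp_norm_def intro: cSUP_upper)
next
  case fin
  let ?q = "enn2real p"
  have "(\<lambda>i. cmod (x i) powr ?q) summable_on UNIV"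
    using assms(2) fin by (simp add: lp_space_def)
  from finite_sum_le_infsum[OF this, of "{i}"]
  have "cmod (x i) powr ?q \<le> (\<Sum>\<^sub>\<infinity>i. cmod (x i) powr ?q)"
    by simp
  then have "(cmod (x i) powr ?q) powr (1 / ?q) \<le> (\<Sum>\<^sub>\<infinity>i. cmod (x i) powr ?q) powr (1 / ?q)"
    using fin by (intro powr_mono2) auto
  then show ?thesis
    using fin by (simp add: lp_norm_def powr_powr)
qed

lemma lp_norm_nonneg: "1 \<le> p \<Longrightarrow> x \<in> lp_space p \<Longrightarrow> 0 \<le> lp_norm p x"
  using lp_entry_le[of p x undefined] norm_ge_zero by (rule order.trans[rotated])

text \<open>The l^1 norm dominates every l^p norm: for finite exponent q, \<open>r i \<le> R\<close>
  gives \<open>r i powr q \<le> R powr (q - 1) * r i\<close>, which sums to \<open>R powr q\<close>.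
  In the application \<open>r\<close> consists of the row sums of a matrix and \<open>N\<close> is
  the norm of the argument.\<close>

lemma lp_dominated:
  assumes "1 \<le> p" "r summable_on UNIV" "\<And>i. 0 \<le> r i" "0 \<le> N" "\<And>i. cmod (y i) \<le> r i * N"
  shows "y \<in> lp_space p" "lp_norm p y \<le> infsum r UNIV * N"
proof -
  define R where "R = infsum r UNIV"
  have rR: "r i \<le> R" for i
    using finite_sum_le_infsum[OF assms(2), of "{i}"] assms(3) by (simp add: R_def)
  have R: "0 \<le> R"
    unfolding R_def by (intro infsum_nonneg assms)
  have yR: "cmod (y i) \<le> R * N" for i
    using assms(5)[of i] mult_right_mono[OF rR[of i] assms(4)] by linarith
  have "y \<in> lp_space p \<and> lp_norm p y \<le> R * N"
    using assms(1)
  proof (cases rule: lp_exponent_cases)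
    case inf
    then show ?thesis
      using yR by (auto simp: lp_space_def lp_norm_def bounded_iff intro!: cSUP_least)
  next
    case fin
    let ?q = "enn2real p"
    have pow: "cmod (y i) powr ?q \<le> (R powr (?q - 1) * N powr ?q) * r i" for i
    proof -
      have "cmod (y i) powr ?q \<le> (r i * N) powr ?q"
        using assms(5) fin by (intro powr_mono2) auto
      also have "\<dots> = r i * r i powr (?q - 1) * N powr ?q"
        using assms(3,4) by (simp add: powr_mult powr_mult_base)
      also have "\<dots> \<le> r i * R powr (?q - 1) * N powr ?q"
        using assms(3) fin rR by (intro mult_right_mono mult_left_mono powr_mono2) auto
      finally show ?thesis
        by (simp add: ac_simps)
    qed
    have s: "(\<lambda>i. (R powr (?q - 1) * N powr ?q) * r i) summable_on UNIV"
      using assms(2) by (rule summable_on_cmult_right)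
    have s': "(\<lambda>i. cmod (y i) powr ?q) summable_on UNIV"
      by (rule summable_on_comparison_test[OF s pow]) auto
    have "(\<Sum>\<^sub>\<infinity>i. cmod (y i) powr ?q) \<le> (\<Sum>\<^sub>\<infinity>i. (R powr (?q - 1) * N powr ?q) * r i)"
      by (rule infsum_mono[OF s' s pow])
    also have "\<dots> = (R * R powr (?q - 1)) * N powr ?q"
      by (simp add: infsum_cmult_right' R_def)
    also have "\<dots> = (R * N) powr ?q"
      using R assms(4) by (simp add: powr_mult powr_mult_base)
    finally have "(\<Sum>\<^sub>\<infinity>i. cmod (y i) powr ?q) powr (1 / ?q) \<le> ((R * N) powr ?q) powr (1 / ?q)"
      using fin by (intro powr_mono2) (auto intro: infsum_nonneg)
    then show ?thesis
      using fin s' R assms(4) by (simp add: lp_space_def lp_norm_def powr_powr)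
  qed
  then show "y \<in> lp_space p" "lp_norm p y \<le> infsum r UNIV * N"
    by (simp_all add: R_def)
qed

text \<open>Any constant would do here: only boundedness of a difference of bounded operators is
  needed, so the crude pointwise estimate replaces Minkowski's inequality.\<close>

lemma lp_diff:
  assumes "1 \<le> p" "x \<in> lp_space p" "y \<in> lp_space p"
  shows "(\<lambda>i. x i - y i) \<in> lp_space p"
    and "lp_norm p (\<lambda>i. x i - y i) \<le> 2 * (lp_norm p x + lp_norm p y)"
proof -
  have X: "0 \<le> lp_norm p x" and Y: "0 \<le> lp_norm p y"
    using assms by (simp_all add: lp_norm_nonneg)
  have "(\<lambda>i. x i - y i) \<in> lp_space p
      \<and> lp_norm p (\<lambda>i. x i - y i) \<le> 2 * (lp_norm p x + lp_norm p y)"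
    using assms(1)
  proof (cases rule: lp_exponent_cases)
    case inf
    have "cmod (x i - y i) \<le> lp_norm p x + lp_norm p y" for i
      using norm_triangle_ineq4[of "x i" "y i"] lp_entry_le[of p x i] lp_entry_le[of p y i] assms
      by linarith
    moreover from this have "cmod (x i - y i) \<le> 2 * (lp_norm p x + lp_norm p y)" for i
      using X Y by (smt (verit))
    ultimately show ?thesis
      using inf by (auto simp: lp_space_def lp_norm_def bounded_iff intro!: cSUP_least)
  next
    case fin
    let ?q = "enn2real p"
    let ?X = "\<Sum>\<^sub>\<infinity>i. cmod (x i) powr ?q" and ?Y = "\<Sum>\<^sub>\<infinity>i. cmod (y i) powr ?q"
    let ?N = "lp_norm p x + lp_norm p y"
    have sx: "(\<lambda>i. cmod (x i) powr ?q) summable_on UNIV"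
      and sy: "(\<lambda>i. cmod (y i) powr ?q) summable_on UNIV"
      using assms fin by (simp_all add: lp_space_def)
    have "0 \<le> ?X" "0 \<le> ?Y"
      by (auto intro: infsum_nonneg)
    then have XX: "?X = lp_norm p x powr ?q" and YY: "?Y = lp_norm p y powr ?q"
      using fin by (simp_all add: lp_norm_def powr_powr)
    \<comment> \<open>The difference is at most twice the larger modulus, and the power of a maximum
      is at most the sum of the powers.\<close>
    have pow: "cmod (x i - y i) powr ?q \<le> 2 powr ?q * (cmod (x i) powr ?q + cmod (y i) powr ?q)" for i
    proof -
      have "cmod (x i - y i) powr ?q \<le> (2 * max (cmod (x i)) (cmod (y i))) powr ?q"
        using fin norm_triangle_ineq4[of "x i" "y i"] by (intro powr_mono2) auto
      also have "\<dots> = 2 powr ?q * max (cmod (x i)) (cmod (y i)) powr ?q"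
        by (simp add: powr_mult le_max_iff_disj)
      also have "\<dots> \<le> 2 powr ?q * (cmod (x i) powr ?q + cmod (y i) powr ?q)"
        by (intro mult_left_mono) (auto simp: max_def)
      finally show ?thesis .
    qed
    have s: "(\<lambda>i. 2 powr ?q * (cmod (x i) powr ?q + cmod (y i) powr ?q)) summable_on UNIV"
      by (intro summable_on_cmult_right summable_on_add sx sy)
    have s': "(\<lambda>i. cmod (x i - y i) powr ?q) summable_on UNIV"
      by (rule summable_on_comparison_test[OF s pow]) auto
    have "(\<Sum>\<^sub>\<infinity>i. cmod (x i - y i) powr ?q)
        \<le> (\<Sum>\<^sub>\<infinity>i. 2 powr ?q * (cmod (x i) powr ?q + cmod (y i) powr ?q))"
      by (rule infsum_mono[OF s' s pow])
    also have "\<dots> = 2 powr ?q * (?X + ?Y)"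
      by (simp only: infsum_cmult_right' infsum_add[OF sx sy])
    \<comment> \<open>Superadditivity of the power q on nonnegative reals: split off one factor and
      enlarge the remaining \<open>q - 1\<close> powers, using \<open>q \<ge> 1\<close>.\<close>
    also have "?X + ?Y \<le> ?N * ?N powr (?q - 1)"
    proof -
      have "?X + ?Y = lp_norm p x * lp_norm p x powr (?q - 1) + lp_norm p y * lp_norm p y powr (?q - 1)"
        using X Y by (simp add: XX YY powr_mult_base)
      also have "\<dots> \<le> lp_norm p x * ?N powr (?q - 1) + lp_norm p y * ?N powr (?q - 1)"
        using X Y fin by (intro add_mono mult_left_mono powr_mono2) auto
      finally show ?thesis
        by (simp add: distrib_right)
    qed
    also have "2 powr ?q * (?N * ?N powr (?q - 1)) = (2 * ?N) powr ?q"
      using X Y powr_mult[of 2 ?N ?q] by (simp add: powr_mult_base)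
    finally have "(\<Sum>\<^sub>\<infinity>i. cmod (x i - y i) powr ?q) powr (1 / ?q) \<le> ((2 * ?N) powr ?q) powr (1 / ?q)"
      using fin by (intro powr_mono2) (auto intro: infsum_nonneg)
    then show ?thesis
      using fin s' X Y by (simp add: lp_space_def lp_norm_def[of p "\<lambda>i. x i - y i"] powr_powr)
  qed
  then show "(\<lambda>i. x i - y i) \<in> lp_space p"
    and "lp_norm p (\<lambda>i. x i - y i) \<le> 2 * (lp_norm p x + lp_norm p y)"
    by auto
qed

section \<open>Absolutely summable matrices as operators\<close>

lemma fmat_row_sums:
  assumes "S \<in> fmat"
  shows "(\<lambda>i. \<Sum>\<^sub>\<infinity>j. cmod (S i j)) summable_on UNIV"
    and "(\<Sum>\<^sub>\<infinity>i. \<Sum>\<^sub>\<infinity>j. cmod (S i j)) = fmat_norm S"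
proof -
  let ?r = "\<lambda>i. \<Sum>\<^sub>\<infinity>j. cmod (S i j)"
  have r: "0 \<le> ?r i" for i
    by (auto intro: infsum_nonneg)
  have eq: "esum (\<lambda>i. ennreal (?r i)) = ennreal (fmat_norm S)"
    using enorm_fmat_eq[OF assms] infsum_conv_nn_integral[OF fmat_row_summable[OF assms]]
    by (simp add: enorm_fmat_def)
  show s: "?r summable_on UNIV"
    using norm_summable_iff_nn_integral[of ?r UNIV] eq r by simp
  show "infsum ?r UNIV = fmat_norm S"
    using infsum_conv_nn_integral[OF s r] eq fmat_norm_nonneg[of S] infsum_nonneg[of UNIV ?r] r by simp
qed

text \<open>Every entry of \<open>x\<close> is at most its norm, so entry \<open>i\<close> of the
  image is at most row sum \<open>i\<close> times that norm. The row sums add up to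
  \<open>fmat_norm S\<close>, and \<open>lp_dominated\<close> treats all exponents at once.\<close>

lemma fmat_apply:
  assumes "1 \<le> p" "S \<in> fmat" "x \<in> lp_space p"
  shows "(\<lambda>j. S i j * x j) summable_on UNIV"
    and "mat_apply S x \<in> lp_space p"
    and "lp_norm p (mat_apply S x) \<le> fmat_norm S * lp_norm p x"
proof -
  show *: "(\<lambda>j. S i j * x j) summable_on UNIV" for i
    by (rule summable_bounded_mult[OF fmat_row_summable]) (auto intro: lp_entry_le assms)
  have "cmod (mat_apply S x i) \<le> (\<Sum>\<^sub>\<infinity>j. cmod (S i j)) * lp_norm p x" for i
  proof -
    have s: "(\<lambda>j. cmod (S i j * x j)) summable_on UNIV"
      using * by (simp add: summable_on_iff_abs_summable_on_complex)
    have "cmod (mat_apply S x i) \<le> (\<Sum>\<^sub>\<infinity>j. cmod (S i j * x j))"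
      unfolding mat_apply_def by (rule norm_infsum_bound[OF s])
    also have "\<dots> \<le> (\<Sum>\<^sub>\<infinity>j. cmod (S i j) * lp_norm p x)"
      by (intro infsum_mono s summable_on_cmult_left fmat_row_summable assms)
         (simp add: norm_mult mult_left_mono lp_entry_le assms)
    also have "\<dots> = (\<Sum>\<^sub>\<infinity>j. cmod (S i j)) * lp_norm p x"
      by (rule infsum_cmult_left')
    finally show ?thesis .
  qed
  from lp_dominated[OF assms(1) fmat_row_sums(1)[OF assms(2)] _ lp_norm_nonneg[OF assms(1,3)] this]
  show "mat_apply S x \<in> lp_space p" "lp_norm p (mat_apply S x) \<le> fmat_norm S * lp_norm p x"
    by (simp_all add: infsum_nonneg fmat_row_sums[OF assms(2)])
qed

lemma fmat_lp_bounded: "1 \<le> p \<Longrightarrow> S \<in> fmat \<Longrightarrow> lp_bounded_op p S"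
  unfolding lp_bounded_op_def using fmat_apply by blast

lemma zero_in_lp: "1 \<le> p \<Longrightarrow> (\<lambda>_. 0) \<in> lp_space p" "1 \<le> p \<Longrightarrow> lp_norm p (\<lambda>_. 0) \<le> 0"
  using lp_dominated[of p "\<lambda>_. 0" 0 "\<lambda>_. 0"] by simp_all

lemma lp_opnorm_fmat_le:
  assumes "1 \<le> p" "S \<in> fmat"
  shows "lp_opnorm p S \<le> fmat_norm S"
  unfolding lp_opnorm_def
proof (rule cSUP_least)
  show "{x \<in> lp_space p. lp_norm p x \<le> 1} \<noteq> {}"
    using zero_in_lp[OF assms(1)] by force
  fix x
  assume "x \<in> {x \<in> lp_space p. lp_norm p x \<le> 1}"
  then show "lp_norm p (mat_apply S x) \<le> fmat_norm S"
    using fmat_apply(3)[OF assms, of x] mult_left_le[OF _ fmat_norm_nonneg, of "lp_norm p x" S]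
    by auto
qed

section \<open>Uniqueness of limits in operator norm\<close>

text \<open>Applying the difference to the unit vector at \<open>j\<close> produces its column
  \<open>j\<close>, whose norm bounds each of its entries. The two operators are bounded separately
  because that is what \<open>lp_op_tendsto\<close> provides.\<close>

lemma lp_entry_le_opnorm_diff:
  assumes p: "1 \<le> p" and S: "lp_bounded_op p S" and R: "lp_bounded_op p R"
  shows "cmod (S i j - R i j) \<le> lp_opnorm p (\<lambda>i j. S i j - R i j)"
proof -
  let ?B = "{x \<in> lp_space p. lp_norm p x \<le> 1}"
  let ?D = "\<lambda>i j. S i j - R i j"
  let ?e = "\<lambda>k. if k = j then 1 else 0 :: complex"
  obtain C where C: "\<And>x. x \<in> lp_space p \<Longrightarrow> lp_norm p (mat_apply S x) \<le> C * lp_norm p x"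
    using S unfolding lp_bounded_op_def by blast
  obtain C' where C': "\<And>x. x \<in> lp_space p \<Longrightarrow> lp_norm p (mat_apply R x) \<le> C' * lp_norm p x"
    using R unfolding lp_bounded_op_def by blast
  have D: "mat_apply ?D x = (\<lambda>i. mat_apply S x i - mat_apply R x i)" if "x \<in> lp_space p" for x
  proof -
    have "(\<lambda>j. S i j * x j) summable_on UNIV" "(\<lambda>j. R i j * x j) summable_on UNIV" for i
      using S R that unfolding lp_bounded_op_def by blast+
    then have "infsum (\<lambda>j. S i j * x j + - (R i j * x j)) UNIV
        = infsum (\<lambda>j. S i j * x j) UNIV + infsum (\<lambda>j. - (R i j * x j)) UNIV" for i
      by (intro infsum_add summable_on_uminus[THEN iffD2]) auto
    then show ?thesis
      by (simp add: mat_apply_def left_diff_distrib infsum_uminus)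
  qed
  have mem: "mat_apply S x \<in> lp_space p" "mat_apply R x \<in> lp_space p" if "x \<in> lp_space p" for x
    using S R that unfolding lp_bounded_op_def by blast+
  \<comment> \<open>The real supremum in \<open>lp_opnorm\<close> bounds its members only over a set
    bounded above. The constants may be negative, hence the absolute values; the factor 2 is that of
    \<open>lp_diff\<close>.\<close>
  have bdd: "bdd_above ((\<lambda>x. lp_norm p (mat_apply ?D x)) ` ?B)"
  proof (rule bdd_aboveI2)
    fix x
    assume x: "x \<in> ?B"
    then have "C * lp_norm p x \<le> \<bar>C\<bar> * 1" "C' * lp_norm p x \<le> \<bar>C'\<bar> * 1"
      using lp_norm_nonneg[OF p, of x] by (intro mult_mono; simp)+
    then show "lp_norm p (mat_apply ?D x) \<le> 2 * (\<bar>C\<bar> + \<bar>C'\<bar>)"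
      using x lp_diff(2)[OF p mem, of x x] C[of x] C'[of x] by (simp add: D)
  qed
  let ?r = "\<lambda>k. if k = j then 1 else 0 :: real"
  have "?r summable_on {j}" "infsum ?r {j} = 1"
    by simp_all
  then have r: "?r summable_on UNIV" "infsum ?r UNIV = 1"
    using summable_on_cong_neutral[of "{j}" UNIV ?r ?r] infsum_cong_neutral[of "{j}" UNIV ?r ?r]
    by auto
  \<comment> \<open>Domination by the indicator of \<open>j\<close>, with \<open>N = 1\<close>,
    bounds the norm by 1 for every exponent.\<close>
  have e: "?e \<in> ?B"
    using lp_dominated[OF p r(1), of 1 ?e] r(2) by simp
  have col: "mat_apply ?D ?e = (\<lambda>i. ?D i j)"
  proof
    fix i
    have "infsum (\<lambda>k. ?D i k * ?e k) UNIV = infsum (\<lambda>k. ?D i k * ?e k) {j}"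
      by (rule infsum_cong_neutral) auto
    then show "mat_apply ?D ?e i = ?D i j"
      by (simp add: mat_apply_def)
  qed
  have "(\<lambda>i. ?D i j) \<in> lp_space p"
    using lp_diff(1)[OF p mem, of ?e ?e] e D[of ?e] col by simp
  from lp_entry_le[OF p this, of i]
  have "cmod (?D i j) \<le> lp_norm p (mat_apply ?D ?e)"
    by (simp only: col)
  also have "\<dots> \<le> lp_opnorm p ?D"
    unfolding lp_opnorm_def by (rule cSUP_upper[OF e bdd])
  finally show ?thesis .
qed

lemma lp_op_tendsto_entry:
  assumes "1 \<le> p" "lp_op_tendsto p M S"
  shows "(\<lambda>k. M k i j) \<longlonglongrightarrow> S i j"
proof -
  have "(\<lambda>k. M k i j - S i j) \<longlonglongrightarrow> 0"
  proof (rule Lim_null_comparison)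
    show "\<forall>\<^sub>F k in sequentially. cmod (M k i j - S i j) \<le> lp_opnorm p (\<lambda>i j. M k i j - S i j)"
      using assms by (auto intro!: always_eventually lp_entry_le_opnorm_diff simp: lp_op_tendsto_def)
    show "(\<lambda>k. lp_opnorm p (\<lambda>i j. M k i j - S i j)) \<longlonglongrightarrow> 0"
      using assms(2) by (simp add: lp_op_tendsto_def)
  qed
  then show ?thesis
    by (simp add: LIM_zero_iff)
qed

text \<open>Operator-norm convergence forces entrywise convergence, so the definite description has
  a unique witness.\<close>

lemma lp_op_lim_eq:
  assumes "1 \<le> p" "lp_op_tendsto p M S"
  shows "lp_op_lim p M = S"
  unfolding lp_op_lim_def
proof (rule the_equality)
  show "lp_op_tendsto p M S"
    by (rule assms(2))
  fix R
  assume "lp_op_tendsto p M R"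
  then show "R = S"
    using lp_op_tendsto_entry[OF assms] lp_op_tendsto_entry[OF assms(1)] LIMSEQ_unique
    by (intro ext) blast
qed

section \<open>Convergence in the norm of absolutely summable matrices\<close>

lemma fmat_diff: "S \<in> fmat \<Longrightarrow> R \<in> fmat \<Longrightarrow> (\<lambda>i j. S i j - R i j) \<in> fmat"
  using enorm_fmat_add[of S "\<lambda>i j. (- 1) * R i j"] enorm_fmat_scale[of "- 1" R]
  by (simp add: fmat_iff le_less_trans)

lemma fmat_tendsto:
  assumes p: "1 \<le> p" and M: "\<And>k. M k \<in> fmat" and S: "S \<in> fmat"
    and lim: "(\<lambda>k. fmat_norm (\<lambda>i j. M k i j - S i j)) \<longlonglongrightarrow> 0"
  shows "lp_op_tendsto p M S"
  unfolding lp_op_tendsto_def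
proof (intro conjI allI fmat_lp_bounded p M S)
  let ?D = "\<lambda>k i j. M k i j - S i j"
  show "(\<lambda>k. lp_opnorm p (?D k)) \<longlonglongrightarrow> 0"
  proof (rule tendsto_sandwich[OF _ _ tendsto_const lim])
    \<comment> \<open>A real supremum is not nonnegative by itself; here it dominates the modulus of
      an entry.\<close>
    show "\<forall>\<^sub>F k in sequentially. 0 \<le> lp_opnorm p (?D k)"
      using lp_entry_le_opnorm_diff[OF p fmat_lp_bounded[OF p M] fmat_lp_bounded[OF p S]]
      by (intro always_eventually allI) (blast intro: order.trans[OF norm_ge_zero])
    show "\<forall>\<^sub>F k in sequentially. lp_opnorm p (?D k) \<le> fmat_norm (?D k)"
      by (intro always_eventually allI lp_opnorm_fmat_le p fmat_diff M S)
  qed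
qed

lemma fmat_norm_scale: "fmat_norm (\<lambda>i j. c * S i j) = cmod c * fmat_norm S"
  by (simp add: fmat_norm_def norm_mult case_prod_beta' infsum_cmult_right')

text \<open>The way back from extended to real norms: a finite bound yields membership and the real
  inequality together.\<close>

lemma fmat_normI:
  assumes "enorm_fmat S \<le> ennreal B" "0 \<le> B"
  shows "S \<in> fmat" "fmat_norm S \<le> B"
proof -
  show "S \<in> fmat"
    using le_less_trans[OF assms(1) ennreal_less_top] by (simp add: fmat_iff)
  then show "fmat_norm S \<le> B"
    using assms by (simp add: enorm_fmat_eq)
qed

text \<open>Completeness in concrete form: the entrywise series converges absolutely, and
  interchanging nonnegative sums moves the sum over \<open>n\<close> outside the norm.\<close>

lemma fmat_suminf:
  assumes X: "\<And>n. X n \<in> fmat" and s: "summable (\<lambda>n. fmat_norm (X n))"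
  shows "(\<lambda>i j. \<Sum>n. X n i j) \<in> fmat" (is "?S \<in> fmat")
    and "fmat_norm (\<lambda>i j. \<Sum>n. X n i j) \<le> (\<Sum>n. fmat_norm (X n))"
proof -
  have "ennreal (cmod (\<Sum>n. X n i j)) \<le> esum (\<lambda>n. ennreal (cmod (X n i j)))" for i j
  proof -
    have sc: "summable (\<lambda>n. cmod (X n i j))"
      by (rule summable_comparison_test'[OF s]) (simp add: cmod_le_fmat_norm X)
    have "ennreal (cmod (\<Sum>n. X n i j)) \<le> ennreal (\<Sum>n. cmod (X n i j))"
      by (intro ennreal_leI summable_norm sc)
    also have "\<dots> = esum (\<lambda>n. ennreal (cmod (X n i j)))"
      using suminf_ennreal2[OF norm_ge_zero sc] by (simp add: nn_integral_count_space_nat)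
    finally show ?thesis .
  qed
  then have "enorm_fmat ?S \<le> esum (\<lambda>i. esum (\<lambda>j. esum (\<lambda>n. ennreal (cmod (X n i j)))))"
    unfolding enorm_fmat_def by (intro esum_mono)
  also have "\<dots> = esum (\<lambda>i. esum (\<lambda>n. esum (\<lambda>j. ennreal (cmod (X n i j)))))"
    by (subst esum_swap) simp
  also have "\<dots> = esum (\<lambda>n. enorm_fmat (X n))"
    unfolding enorm_fmat_def by (rule esum_swap)
  also have "\<dots> = (\<Sum>n. ennreal (fmat_norm (X n)))"
    by (simp add: enorm_fmat_eq X nn_integral_count_space_nat)
  also have "\<dots> = ennreal (\<Sum>n. fmat_norm (X n))"
    by (rule suminf_ennreal2[OF fmat_norm_nonneg s])
  finally show "?S \<in> fmat" "fmat_norm ?S \<le> (\<Sum>n. fmat_norm (X n))"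
    by (rule fmat_normI; simp add: suminf_nonneg s fmat_norm_nonneg)+
qed

lemma fmat_sum: "(\<And>n. n \<in> I \<Longrightarrow> X n \<in> fmat) \<Longrightarrow> (\<lambda>i j. \<Sum>n\<in>I. X n i j) \<in> fmat"
proof (induction I rule: infinite_finite_induct)
  case (insert n I)
  then show ?case
    using enorm_fmat_add[of "X n" "\<lambda>i j. \<Sum>n\<in>I. X n i j"] by (simp add: fmat_iff le_less_trans)
qed (simp_all add: fmat_iff enorm_fmat_def)

text \<open>The error of a partial sum is minus a tail series, whose norm is at most the tail of a
  convergent real series.\<close>

lemma lp_op_tendsto_suminf:
  assumes p: "1 \<le> p" and X: "\<And>n. X n \<in> fmat" and s: "summable (\<lambda>n. fmat_norm (X n))"
  shows "lp_op_tendsto p (\<lambda>k i j. \<Sum>n\<le>k. X n i j) (\<lambda>i j. \<Sum>n. X n i j)"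
proof (rule fmat_tendsto[OF p fmat_sum[OF X] fmat_suminf(1)[OF X s]])
  let ?t = "\<lambda>k. \<Sum>n. fmat_norm (X (n + Suc k))"
  have *: "fmat_norm (\<lambda>i j. (\<Sum>n\<le>k. X n i j) - (\<Sum>n. X n i j)) \<le> ?t k" for k
  proof -
    have "(\<Sum>n\<le>k. X n i j) - (\<Sum>n. X n i j) = - (\<Sum>n. X (n + Suc k) i j)" for i j
    proof -
      have "summable (\<lambda>n. X n i j)"
        by (rule summable_comparison_test'[OF s]) (simp add: cmod_le_fmat_norm X)
      from suminf_split_initial_segment[OF this, of "Suc k"] show ?thesis
        by (simp add: lessThan_Suc_atMost)
    qed
    moreover have "fmat_norm (\<lambda>i j. - (\<Sum>n. X (n + Suc k) i j)) = fmat_norm (\<lambda>i j. \<Sum>n. X (n + Suc k) i j)"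
      by (simp add: fmat_norm_def)
    moreover have "fmat_norm (\<lambda>i j. \<Sum>n. X (n + Suc k) i j) \<le> ?t k"
      by (intro fmat_suminf(2) X summable_ignore_initial_segment s)
    ultimately show ?thesis
      by simp
  qed
  have "?t \<longlonglongrightarrow> 0"
    \<comment> \<open>Partial sums include \<open>n = k\<close>, so the tail starts at
      \<open>Suc k\<close>.\<close>
    using suminf_exist_split2[OF s] by (rule LIMSEQ_Suc)
  then show "(\<lambda>k. fmat_norm (\<lambda>i j. (\<Sum>n\<le>k. X n i j) - (\<Sum>n. X n i j))) \<longlonglongrightarrow> 0"
    by (rule Lim_null_comparison[rotated]) (use * in \<open>simp add: fmat_norm_nonneg\<close>)
qed

section \<open>Powers of a perturbed Toeplitz matrix\<close>

lemma fmat_power_diff_Suc: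
  assumes a: "a \<in> wiener" and a': "laurent_deriv a \<in> wiener" and E: "E \<in> fmat"
    and A_def: "A = (\<lambda>r s. toeplitz a r s + E r s)"
    and D_def: "\<And>i. D i = (\<lambda>r s. mat_power A i r s - toeplitz (laurent_power a i) r s)"
    and D: "D n \<in> fmat"
  shows "D (Suc n) \<in> fmat"
    and "fmat_norm (D (Suc n)) \<le> (wiener_norm a + fmat_norm E) * fmat_norm (D n)
      + (real n * wiener_norm a ^ (n - 1) * (wiener_norm (laurent_deriv a))\<^sup>2
         + wiener_norm a ^ n * fmat_norm E)" (is "_ \<le> ?B")
proof -
  let ?T = "toeplitz a" and ?b = "laurent_power a n"
  let ?Tb = "toeplitz ?b"
  have b: "?b \<in> wiener"
    by (rule wiener_power[OF a])
  have bd: "cmod (D n k j) \<le> fmat_norm (D n)" "cmod (?Tb k j) \<le> wiener_norm ?b" for k j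
    using D b by (auto simp: toeplitz_def intro: cmod_le_fmat_norm cmod_le_wiener_norm)
  \<comment> \<open>Each series pairs an absolutely summable row with a bounded column, which
    justifies distributing the products below.\<close>
  have summ: "(\<lambda>k. ?T i k * D n k j) summable_on UNIV" "(\<lambda>k. ?T i k * ?Tb k j) summable_on UNIV"
    "(\<lambda>k. E i k * D n k j) summable_on UNIV" "(\<lambda>k. E i k * ?Tb k j) summable_on UNIV" for i j
    by (rule summable_bounded_mult[OF toeplitz_row_summable[OF a] bd(1)]
        summable_bounded_mult[OF toeplitz_row_summable[OF a] bd(2)]
        summable_bounded_mult[OF fmat_row_summable[OF E] bd(1)]
        summable_bounded_mult[OF fmat_row_summable[OF E] bd(2)])+
  have "mat_power A n = (\<lambda>r s. D n r s + ?Tb r s)"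
    by (simp add: D_def)
  moreover have "(\<lambda>k. ?T i k * (D n k j + ?Tb k j)) summable_on UNIV"
    "(\<lambda>k. E i k * (D n k j + ?Tb k j)) summable_on UNIV" for i j
    using summ[of i j] by (auto simp: distrib_left intro: summable_on_add)
  ultimately have mult: "mat_power A (Suc n) = (\<lambda>r s. (mat_mult ?T (D n) r s + mat_mult ?T ?Tb r s)
      + (mat_mult E (D n) r s + mat_mult E ?Tb r s))"
    using summ by (simp add: A_def mat_mult_add_left mat_mult_add_right)
  let ?H = "\<lambda>r s. mat_mult ?T ?Tb r s - toeplitz (laurent_mult a ?b) r s"
  \<comment> \<open>The Toeplitz matrix subtracted in \<open>D (Suc n)\<close> is absorbed into
    \<open>?H\<close>, so that all four summands are absolutely summable.\<close>
  have "D (Suc n) = (\<lambda>r s. (mat_mult ?T (D n) r s + ?H r s) + (mat_mult E (D n) r s + mat_mult E ?Tb r s))"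
    unfolding D_def[of "Suc n"] mult by (simp add: algebra_simps)
  then have "enorm_fmat (D (Suc n))
      \<le> (enorm_fmat (mat_mult ?T (D n)) + enorm_fmat ?H)
        + (enorm_fmat (mat_mult E (D n)) + enorm_fmat (mat_mult E ?Tb))"
    by (simp only:) (rule order.trans[OF enorm_fmat_add add_mono[OF enorm_fmat_add enorm_fmat_add]])
  also have "\<dots> \<le> (enorm_wiener a * enorm_fmat (D n) + enorm_deriv a * enorm_deriv ?b)
        + (enorm_fmat E * enorm_fmat (D n) + enorm_fmat E * enorm_wiener ?b)"
    by (intro add_mono enorm_toeplitz_mult enorm_toeplitz_mult_diff enorm_fmat_mult
        enorm_mult_toeplitz a b)
  also have "\<dots> \<le> (enorm_wiener a * enorm_fmat (D n)
          + enorm_deriv a * (of_nat n * enorm_wiener a ^ (n - 1) * enorm_deriv a))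
        + (enorm_fmat E * enorm_fmat (D n) + enorm_fmat E * enorm_wiener a ^ n)"
    by (intro add_mono mult_left_mono enorm_deriv_power enorm_wiener_power order.refl zero_le)
  \<comment> \<open>All norms involved are finite, so the bound becomes a real number.\<close>
  also have "\<dots> = ennreal ?B"
    by (simp add: enorm_wiener_eq a a' enorm_fmat_eq E D wiener_norm_nonneg fmat_norm_nonneg
        ennreal_of_nat_eq_real_of_nat algebra_simps power2_eq_square ennreal_mult
        flip: enorm_deriv_eq ennreal_power)
  finally show "D (Suc n) \<in> fmat" "fmat_norm (D (Suc n)) \<le> ?B"
    by (rule fmat_normI; simp add: wiener_norm_nonneg fmat_norm_nonneg)+
qed

section \<open>Scalar recursions and the exponential series\<close>

lemma affine_recursion_bound:
  fixes x g :: "nat \<Rightarrow> real"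
  assumes "0 \<le> c" "x 0 \<le> 0" "\<And>n. x (Suc n) \<le> c * x n + g (Suc n)"
  shows "x n \<le> (\<Sum>j<n. c ^ j * g (n - j))"
proof (induction n)
  case (Suc n)
  have "x (Suc n) \<le> c * (\<Sum>j<n. c ^ j * g (n - j)) + g (Suc n)"
    using assms(3)[of n] mult_left_mono[OF Suc assms(1)] by linarith
  also have "\<dots> = (\<Sum>j<Suc n. c ^ j * g (Suc n - j))"
    \<comment> \<open>The new inhomogeneity is the term \<open>j = 0\<close>; multiplication by
      \<open>c\<close> shifts the others.\<close>
    by (subst sum.lessThan_Suc_shift) (simp add: sum_distrib_left ac_simps)
  finally show ?case .
qed (use assms(2) in simp)

text \<open>After enlarging \<open>\<alpha>\<close> to \<open>c\<close>, the bound solves the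
  recursion with equality from 0: the coefficient of \<open>d\<close> accumulates 0 + 1 + ... + (n -
  1), that of \<open>e\<close> accumulates n ones.\<close>

lemma power_diff_bound:
  fixes x :: "nat \<Rightarrow> real"
  assumes \<alpha>: "0 \<le> \<alpha>" "\<alpha> \<le> c" and de: "0 \<le> d" "0 \<le> e" and x0: "x 0 \<le> 0"
    and x: "\<And>n. x (Suc n) \<le> c * x n + (real n * \<alpha> ^ (n - 1) * d + \<alpha> ^ n * e)"
  shows "x n \<le> real n * (real n - 1) / 2 * c ^ (n - 2) * d + real n * c ^ (n - 1) * e"
proof (induction n)
  case (Suc n)
  have c: "0 \<le> c"
    using \<alpha> by linarith
  have "x (Suc n) \<le> c * x n + (real n * c ^ (n - 1) * d + c ^ n * e)"
  proof -
    have "real n * \<alpha> ^ (n - 1) * d + \<alpha> ^ n * e \<le> real n * c ^ (n - 1) * d + c ^ n * e"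
      using \<alpha> de by (intro add_mono mult_right_mono mult_left_mono power_mono) auto
    then show ?thesis
      using x[of n] by linarith
  qed
  also have "c * x n \<le> c * (real n * (real n - 1) / 2 * c ^ (n - 2) * d + real n * c ^ (n - 1) * e)"
    by (rule mult_left_mono[OF Suc c])
  also have "c * (real n * (real n - 1) / 2 * c ^ (n - 2) * d + real n * c ^ (n - 1) * e)
      + (real n * c ^ (n - 1) * d + c ^ n * e)
    = real (Suc n) * (real (Suc n) - 1) / 2 * c ^ (Suc n - 2) * d + real (Suc n) * c ^ (Suc n - 1) * e"
  proof -
    \<comment> \<open>The exponents \<open>n - 1\<close> and \<open>n - 2\<close> truncate for small
      \<open>n\<close>, where their coefficients vanish.\<close>
    consider "n = 0" | "n = 1" | m where "n = Suc (Suc m)"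
      by (metis One_nat_def not0_implies_Suc)
    then show ?thesis
      by cases (simp_all add: field_simps)
  qed
  finally show ?case
    by simp
qed (use x0 in simp)

text \<open>Cancelling \<open>n\<close> or \<open>n * (n - 1)\<close> against the factorial leaves
  the exponential series shifted by one or two places; the initial terms are zero.\<close>

lemma power_diff_bound_sums:
  fixes c d e :: real
  shows "(\<lambda>n. 1 / fact n * (real n * (real n - 1) / 2 * c ^ (n - 2) * d + real n * c ^ (n - 1) * e))
    sums ((1/2 * d + e) * exp c)"
proof -
  have ex: "(\<lambda>n. c ^ n / fact n) sums exp c"
    using exp_converges[of c] by (simp add: field_simps)
  have "(\<lambda>n. 1 / fact (n + 1) * (real (n + 1) * c ^ (n + 1 - 1))) sums exp c"
  proof -
    have "1 / fact (n + 1) * (real (n + 1) * c ^ (n + 1 - 1)) = c ^ n / fact n" for n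
      by (simp add: divide_simps)
    then show ?thesis
      using ex by (simp only:)
  qed
  then have 1: "(\<lambda>n. 1 / fact n * (real n * c ^ (n - 1))) sums exp c"
    by (subst sums_iff_shift'[of _ 1, symmetric]) simp
  have "(\<lambda>n. 1 / fact (n + 2) * (real (n + 2) * (real (n + 2) - 1) * c ^ (n + 2 - 2))) sums exp c"
  proof -
    have "1 / fact (n + 2) * (real (n + 2) * (real (n + 2) - 1) * c ^ (n + 2 - 2)) = c ^ n / fact n" for n
      by (simp add: divide_simps)
    then show ?thesis
      using ex by (simp only:)
  qed
  then have 2: "(\<lambda>n. 1 / fact n * (real n * (real n - 1) * c ^ (n - 2))) sums exp c"
    by (subst sums_iff_shift'[of _ 2, symmetric]) (simp add: numeral_2_eq_2)
  show ?thesis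
    using sums_add[OF sums_mult2[OF 2, of "d / 2"] sums_mult2[OF 1, of e]]
    by (simp add: algebra_simps add_divide_distrib diff_divide_distrib)
qed

text \<open>Membership and convergence are part of the conclusion because \<open>fmat_norm\<close>
  and \<open>lp_op_lim\<close> carry meaning only with them. In \<open>\<gamma> 1\<close> the
  truncated exponent is harmless, as its coefficient is 0; the sum evaluates \<open>\<gamma>\<close>
  at positive indices only.\<close>

theorem theorem4p1:
  fixes a :: "int \<Rightarrow> complex" and E :: smat and p :: ennreal
    and A F :: smat and D Fk :: "nat \<Rightarrow> smat" and \<gamma> :: "nat \<Rightarrow> real"
  assumes a: "a \<in> wiener" and a': "laurent_deriv a \<in> wiener"
    and E: "E \<in> fmat"
    and p: "1 \<le> p"
  defines "A \<equiv> (\<lambda>r s. toeplitz a r s + E r s)"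
    and "D \<equiv> (\<lambda>i r s. mat_power A i r s - toeplitz (laurent_power a i) r s)"
    and "Fk \<equiv> (\<lambda>k r s. \<Sum>i\<le>k. 1 / fact i * D i r s)"
    and "F \<equiv> lp_op_lim p Fk"
    and "\<gamma> \<equiv> (\<lambda>i. (real i - 1) * wiener_norm a ^ (i - 2) * (wiener_norm (laurent_deriv a))\<^sup>2
                + wiener_norm a ^ (i - 1) * fmat_norm E)"
  shows "(\<forall>i. D i \<in> fmat \<and>
            fmat_norm (D i) \<le> (\<Sum>j<i. (wiener_norm a + fmat_norm E) ^ j * \<gamma> (i - j)))
       \<and> lp_op_tendsto p Fk F \<and> F \<in> fmat
       \<and> fmat_norm F \<le> (1/2 * (wiener_norm (laurent_deriv a))\<^sup>2 + fmat_norm E)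
                         * exp (wiener_norm a + fmat_norm E)"
proof -
  let ?c = "wiener_norm a + fmat_norm E" and ?d = "(wiener_norm (laurent_deriv a))\<^sup>2"
  let ?u = "\<lambda>n. real n * (real n - 1) / 2 * ?c ^ (n - 2) * ?d + real n * ?c ^ (n - 1) * fmat_norm E"
  have A_eq: "A = (\<lambda>r s. toeplitz a r s + E r s)"
    by (simp add: A_def)
  have D_eq: "D i = (\<lambda>r s. mat_power A i r s - toeplitz (laurent_power a i) r s)" for i
    by (simp add: D_def)
  \<comment> \<open>The zeroth power of \<open>a\<close> is the constant series 1, whose Toeplitz
    matrix is the identity.\<close>
  have D0: "D 0 = (\<lambda>r s. 0)"
    by (auto simp: D_def toeplitz_def fun_eq_iff)
  have D: "D n \<in> fmat" for n
  proof (induction n)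
    case 0
    then show ?case
      by (simp add: D0 fmat_iff enorm_fmat_def)
  next
    case (Suc n)
    show ?case
      by (rule fmat_power_diff_Suc(1)[where D = D, OF a a' E A_eq D_eq Suc])
  qed
  have x0: "fmat_norm (D 0) \<le> 0"
    by (simp add: D0 fmat_norm_def case_prod_beta')
  have step: "fmat_norm (D (Suc n)) \<le> ?c * fmat_norm (D n)
      + (real n * wiener_norm a ^ (n - 1) * ?d + wiener_norm a ^ n * fmat_norm E)" for n
    by (rule fmat_power_diff_Suc(2)[where D = D, OF a a' E A_eq D_eq D])
  have Dn: "fmat_norm (D n) \<le> (\<Sum>j<n. ?c ^ j * \<gamma> (n - j))" for n
  proof (rule affine_recursion_bound[where x = "\<lambda>n. fmat_norm (D n)", OF _ x0])
    fix n
    show "fmat_norm (D (Suc n)) \<le> ?c * fmat_norm (D n) + \<gamma> (Suc n)"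
      using step[of n] by (simp add: \<gamma>_def numeral_2_eq_2)
  qed (simp add: wiener_norm_nonneg fmat_norm_nonneg)
  have u: "fmat_norm (D n) \<le> ?u n" for n
    by (rule power_diff_bound[where x = "\<lambda>n. fmat_norm (D n)", OF _ _ _ _ x0 step]) (simp_all add: wiener_norm_nonneg fmat_norm_nonneg)
  let ?X = "\<lambda>n r s. 1 / fact n * D n r s"
  have X: "?X n \<in> fmat" for n
    using D[of n] unfolding fmat_iff enorm_fmat_scale by (simp add: ennreal_mult_less_top)
  have nX: "fmat_norm (?X n) = 1 / fact n * fmat_norm (D n)" for n
    unfolding fmat_norm_scale by (simp add: norm_divide)
  have le: "fmat_norm (?X n) \<le> 1 / fact n * ?u n" for n
    unfolding nX by (rule mult_left_mono[OF u]) simp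
  note sums = power_diff_bound_sums[of ?c ?d "fmat_norm E"]
  have s: "summable (\<lambda>n. fmat_norm (?X n))"
    using le by (intro summable_comparison_test'[OF sums_summable[OF sums]]) (simp add: fmat_norm_nonneg)
  \<comment> \<open>Convergence to the entrywise series comes first; uniqueness then identifies
    \<open>F\<close> with it.\<close>
  have lim: "lp_op_tendsto p Fk (\<lambda>r s. \<Sum>n. ?X n r s)"
    unfolding Fk_def by (rule lp_op_tendsto_suminf[OF p X s])
  then have F: "F = (\<lambda>r s. \<Sum>n. ?X n r s)"
    unfolding F_def by (rule lp_op_lim_eq[OF p])
  have "fmat_norm F \<le> (\<Sum>n. fmat_norm (?X n))"
    unfolding F by (rule fmat_suminf(2)[OF X s])
  also have "\<dots> \<le> (1/2 * ?d + fmat_norm E) * exp ?c"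
    by (rule sums_le[OF le summable_sums[OF s] sums])
  finally show ?thesis
    using Dn D lim fmat_suminf(1)[OF X s] unfolding F by blast
qed

end
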